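(* Let $A$ be a real $m\times n$ matrix, $r$ be a positive integer, $\mathcal{I}\subseteq\{1,\dots,n\}$ be a fixed index set, and let $\|\cdot\|$ denote any vector norm (on $\mathbb{R}^r$). Then all $X_0\in\mathbb{R}^{n\times r}$ with $\mathrm{Supp}_{\mathrm{row}}(X_0)\subseteq\mathcal{I}$ can be uniquely recovered from $B=AX_0$ using the sum-of-norms problem $$\min_{X\in\mathbb{R}^{n\times r}}\ \sum_{j=1}^n\|X^{j\rightarrow}\|\quad\text{subject to}\quad AX=B$$ if and only if for all $Z\in\mathbb{R}^{n\times r}$ with columns $Z^{\downarrow k}\in\mathrm{Ker}(A)\setminus\{0\}$, $k=1,\dots,r$, $$\sum_{j\in\mathcal{I}}\|Z^{j\rightarrow}\|<\sum_{j\notin\mathcal{I}}\|Z^{j\rightarrow}\|.$$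
   Context: For a matrix $X\in\mathbb{R}^{n\times r}$, $X^{j\rightarrow}\in\mathbb{R}^r$ denotes the $j$th row of $X$ regarded as a column vector, and $X^{\downarrow k}\in\mathbb{R}^n$ denotes its $k$th column. The row support is $\mathrm{Supp}_{\mathrm{row}}(X)=\{j\mid\|X^{j\rightarrow}\|\neq 0\}$. $\mathrm{Ker}(A)=\{x\in\mathbb{R}^n\mid Ax=0\}$. "Uniquely recovered" means that $X_0$ is the unique solution of the stated minimization problem with $B=AX_0$.
   Formalization: The condition on Z is read as: all columns lie in Ker(A) and Z is not the zero matrix (single columns may vanish); requiring every column to be nonzero makes the "if" direction false for some norms, e.g. r = 4 with N(x,t) = max|x_i| + |t|. *)

theory Defs
  imports "HOL-Analysis.Analysis"
begin

text \<open>
  An \<open>n \<times> r\<close> matrix is an element of \<^typ>\<open>real ^ 'r ^ 'n\<close> (its rows are indexed by \<open>'n\<close>, its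
  columns by \<open>'r\<close>), and an \<open>m \<times> n\<close> matrix is an element of \<^typ>\<open>real ^ 'n ^ 'm\<close>.
\<close>

text \<open>
  The type class constant \<^const>\<open>norm\<close> is the Euclidean norm on \<^typ>\<open>real ^ 'r\<close>. An arbitrary
  vector norm is therefore an explicit function satisfying the norm axioms.
\<close>

definition vector_norm :: "('a::real_vector \<Rightarrow> real) \<Rightarrow> bool" where
  "vector_norm N \<longleftrightarrow>
     (\<forall>x. 0 \<le> N x) \<and>
     (\<forall>x. N x = 0 \<longleftrightarrow> x = 0) \<and>
     (\<forall>c x. N (c *\<^sub>R x) = \<bar>c\<bar> * N x) \<and>
     (\<forall>x y. N (x + y) \<le> N x + N y)"

definition Ker :: "real ^ 'n ^ 'm \<Rightarrow> (real ^ 'n) set" where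
  "Ker A = {x. A *v x = 0}"

definition row_support :: "(real ^ 'r \<Rightarrow> real) \<Rightarrow> real ^ 'r ^ 'n \<Rightarrow> 'n set" where
  "row_support N X = {j. N (row j X) \<noteq> 0}"

definition sum_of_norms :: "(real ^ 'r \<Rightarrow> real) \<Rightarrow> real ^ 'r ^ 'n \<Rightarrow> real" where
  "sum_of_norms N X = (\<Sum>j\<in>UNIV. N (row j X))"

definition sum_of_norms_solution ::
    "(real ^ 'r \<Rightarrow> real) \<Rightarrow> real ^ 'n ^ 'm \<Rightarrow> real ^ 'r ^ 'm \<Rightarrow> real ^ 'r ^ 'n \<Rightarrow> bool" where
  "sum_of_norms_solution N A B X \<longleftrightarrow> is_arg_min (sum_of_norms N) (\<lambda>Y. A ** Y = B) X"

definition uniquely_recovered ::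
    "(real ^ 'r \<Rightarrow> real) \<Rightarrow> real ^ 'n ^ 'm \<Rightarrow> real ^ 'r ^ 'n \<Rightarrow> bool" where
  "uniquely_recovered N A X0 \<longleftrightarrow>
     (\<forall>X. sum_of_norms_solution N A (A ** X0) X \<longleftrightarrow> X = X0)"

text \<open>
  Kernel matrices: the tuple of columns lies in \<open>Ker(A)\<^sup>r \ {0}\<close>. Individual columns may vanish,
  only the zero matrix is excluded. Demanding that every single column be nonzero would give a
  condition that is too weak to imply unique recovery for general norms (e.g. \<open>r = 4\<close> with
  \<open>N(x,t) = max\<^sub>i |x\<^sub>i| + |t|\<close>, \<open>x \<in> \<real>\<^sup>3\<close>, and a suitable \<open>A\<close>).
\<close>

definition nonzero_kernel_matrix :: "real ^ 'n ^ 'm \<Rightarrow> real ^ 'r ^ 'n \<Rightarrow> bool" where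
  "nonzero_kernel_matrix A Z \<longleftrightarrow> Z \<noteq> 0 \<and> (\<forall>k. column k Z \<in> Ker A)"

end

theory Submission
  imports Defs
begin

text \<open>
  Two feasible points differ by a kernel matrix \<open>Z\<close>. Moving from \<open>X0\<close>, whose rows vanish
  outside \<open>I\<close>, to \<open>X0 + Z\<close> lowers the objective by at most the norm mass of \<open>Z\<close> on \<open>I\<close> and raises
  it by the mass of \<open>Z\<close> on \<open>-I\<close>. Conversely, a kernel matrix \<open>Z\<close> is the difference of its
  restriction to \<open>I\<close> and the negative of its restriction to \<open>-I\<close>, which have the same image
  under \<open>A\<close>; recovery of the former makes it strictly cheaper than the latter.
\<close>

lemma matrix_diff_ldistrib:
  fixes A :: "'a::ring_1 ^ 'n ^ 'm"
  shows "A ** (B - C) = A ** B - A ** C"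
  using matrix_add_ldistrib[of A "B - C" C] by simp

text \<open>Matrix multiplication acts column by column, so the condition on columns becomes one
  linear equation that works with \<open>**\<close> alone.\<close>

lemma column_mem_Ker_iff: "(\<forall>k. column k Z \<in> Ker A) \<longleftrightarrow> A ** Z = 0"
proof -
  have "(A *v column k Z) $ i = (A ** Z) $ i $ k" for i k
    by (simp add: matrix_vector_mult_def matrix_matrix_mult_def column_def)
  then show ?thesis
    unfolding Ker_def vec_eq_iff by auto
qed

lemma nonzero_kernel_matrix_iff: "nonzero_kernel_matrix A Z \<longleftrightarrow> Z \<noteq> 0 \<and> A ** Z = 0"
  by (simp add: nonzero_kernel_matrix_def column_mem_Ker_iff)

text \<open>Both directions of the equivalence compare the objective at two feasible points, so
  unique recovery is put in a form free of \<open>is_arg_min\<close>.\<close>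

lemma uniquely_recovered_iff:
  "uniquely_recovered N A X0 \<longleftrightarrow>
     (\<forall>Y. A ** Y = A ** X0 \<longrightarrow> Y \<noteq> X0 \<longrightarrow> sum_of_norms N X0 < sum_of_norms N Y)"
proof
  assume rec: "uniquely_recovered N A X0"
  show "\<forall>Y. A ** Y = A ** X0 \<longrightarrow> Y \<noteq> X0 \<longrightarrow> sum_of_norms N X0 < sum_of_norms N Y"
  proof (intro allI impI)
    fix Y assume Y: "A ** Y = A ** X0" "Y \<noteq> X0"
    have sol: "is_arg_min (sum_of_norms N) (\<lambda>Y. A ** Y = A ** X0) X \<longleftrightarrow> X = X0" for X
      using rec by (simp add: uniquely_recovered_def sum_of_norms_solution_def)
    \<comment> \<open>\<open>Y\<close> is feasible but not a minimizer, so some feasible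
      \<open>Y'\<close> strictly undercuts it; \<open>X0\<close>, being minimal, costs at most as
      much as \<open>Y'\<close>.\<close>
    obtain Y' where "A ** Y' = A ** X0" "sum_of_norms N Y' < sum_of_norms N Y"
      using sol[of Y] Y by (auto simp: is_arg_min_def)
    moreover from this(1) have "sum_of_norms N X0 \<le> sum_of_norms N Y'"
      using sol[of X0] by (auto simp: is_arg_min_linorder)
    ultimately show "sum_of_norms N X0 < sum_of_norms N Y"
      by linarith
  qed
next
  assume less: "\<forall>Y. A ** Y = A ** X0 \<longrightarrow> Y \<noteq> X0 \<longrightarrow> sum_of_norms N X0 < sum_of_norms N Y"
  show "uniquely_recovered N A X0"
    unfolding uniquely_recovered_def sum_of_norms_solution_def is_arg_min_def
    using less by (blast intro: less_asym)
qed

lemma vector_norm_minus: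
  assumes "vector_norm N"
  shows "N (- x) = N x"
proof -
  have "N ((- 1) *\<^sub>R x) = \<bar>- 1\<bar> * N x"
    using assms unfolding vector_norm_def by blast
  then show ?thesis by simp
qed

lemma sum_of_norms_split:
  fixes X :: "real ^ 'r ^ 'n"
  shows "sum_of_norms N X = (\<Sum>j\<in>I. N (row j X)) + (\<Sum>j\<in>-I. N (row j X))"
  unfolding sum_of_norms_def
  by (subst sum.union_disjoint[symmetric]) auto

lemma sum_less_of_recovery:
  fixes A :: "real ^ 'n ^ 'm" and Z :: "real ^ 'r ^ 'n"
  assumes N: "vector_norm N"
    and rec: "\<And>X0 :: real ^ 'r ^ 'n. row_support N X0 \<subseteq> I \<Longrightarrow> uniquely_recovered N A X0"
    and Z: "Z \<noteq> 0" "A ** Z = 0"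
  shows "(\<Sum>j\<in>I. N (row j Z)) < (\<Sum>j\<in>-I. N (row j Z))"
proof -
  have N0: "N 0 = 0"
    using N by (simp add: vector_norm_def)
  define X0 :: "real ^ 'r ^ 'n" where "X0 = (\<chi> j. if j \<in> I then row j Z else 0)"
  have row_X0: "row j X0 = (if j \<in> I then row j Z else 0)" for j
    by (simp add: X0_def row_def vec_eq_iff)
  have row_diff: "row j (X0 - Z) = (if j \<in> I then 0 else - row j Z)" for j
    by (simp add: X0_def row_def vec_eq_iff)
  have "row_support N X0 \<subseteq> I"
    by (auto simp: row_support_def row_X0 N0 split: if_splits)
  moreover have "A ** (X0 - Z) = A ** X0"
    using Z by (simp add: matrix_diff_ldistrib)
  moreover have "X0 - Z \<noteq> X0"
    using Z by simp
  ultimately have "sum_of_norms N X0 < sum_of_norms N (X0 - Z)"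
    using rec uniquely_recovered_iff by blast
  \<comment> \<open>On \<open>I\<close> the rows of \<open>X0 - Z\<close> cancel and off
    \<open>I\<close> those of \<open>X0\<close> vanish, so each side keeps just one of its two
    sums.\<close>
  then show ?thesis
    by (simp add: sum_of_norms_split[where I = I] row_X0 row_diff N0 vector_norm_minus[OF N])
qed

lemma recovery_of_sum_less:
  fixes A :: "real ^ 'n ^ 'm" and X0 :: "real ^ 'r ^ 'n"
  assumes N: "vector_norm N"
    and less: "\<And>Z :: real ^ 'r ^ 'n. Z \<noteq> 0 \<Longrightarrow> A ** Z = 0 \<Longrightarrow>
      (\<Sum>j\<in>I. N (row j Z)) < (\<Sum>j\<in>-I. N (row j Z))"
    and supp: "row_support N X0 \<subseteq> I"
  shows "uniquely_recovered N A X0"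
  unfolding uniquely_recovered_iff
proof (intro allI impI)
  fix Y :: "real ^ 'r ^ 'n"
  assume Y: "A ** Y = A ** X0" "Y \<noteq> X0"
  define Z where "Z = Y - X0"
  have Z: "(\<Sum>j\<in>I. N (row j Z)) < (\<Sum>j\<in>-I. N (row j Z))"
    using Y by (intro less) (simp_all add: Z_def matrix_diff_ldistrib)
  have row_Z: "row j Z = row j Y - row j X0" for j
    by (simp add: Z_def row_def vec_eq_iff)
  have tri: "N (x + y) \<le> N x + N y" for x y
    using N by (simp add: vector_norm_def)
  \<comment> \<open>Triangle inequality for \<open>X0 = Y - Z\<close>, row by row. It is summed over
    \<open>I\<close> only, since off \<open>I\<close> equalities hold.\<close>
  have "N (row j X0) \<le> N (row j Y) + N (row j Z)" for j
    using tri[of "row j Y" "- row j Z"] unfolding vector_norm_minus[OF N] by (simp add: row_Z)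
  then have "(\<Sum>j\<in>I. N (row j X0)) \<le> (\<Sum>j\<in>I. N (row j Y)) + (\<Sum>j\<in>I. N (row j Z))"
    by (simp add: sum_mono flip: sum.distrib)
  moreover have X0_zero: "row j X0 = 0" if "j \<in> - I" for j
    using that supp N by (auto simp: row_support_def vector_norm_def)
  then have "(\<Sum>j\<in>-I. N (row j X0)) = 0"
    using N by (simp add: vector_norm_def)
  moreover have "(\<Sum>j\<in>-I. N (row j Z)) = (\<Sum>j\<in>-I. N (row j Y))"
    using X0_zero by (simp add: row_Z)
  \<comment> \<open>Off \<open>I\<close> the rows of \<open>Z\<close> and \<open>Y\<close> agree, so
    the mass of \<open>Z\<close> on \<open>I\<close> is strictly below that of \<open>Y\<close> off
    \<open>I\<close>, which closes the chain.\<close>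
  ultimately show "sum_of_norms N X0 < sum_of_norms N Y"
    using Z by (simp add: sum_of_norms_split[where I = I])
qed

theorem theorem3p1:
  fixes A :: "real ^ 'n ^ 'm"
    and I :: "'n set"
    and N :: "real ^ 'r \<Rightarrow> real"
  assumes "vector_norm N"
  shows "(\<forall>X0 :: real ^ 'r ^ 'n. row_support N X0 \<subseteq> I \<longrightarrow> uniquely_recovered N A X0) \<longleftrightarrow>
         (\<forall>Z :: real ^ 'r ^ 'n. nonzero_kernel_matrix A Z \<longrightarrow>
            (\<Sum>j\<in>I. N (row j Z)) < (\<Sum>j\<in>-I. N (row j Z)))"
  unfolding nonzero_kernel_matrix_iff
  using sum_less_of_recovery[OF assms] recovery_of_sum_less[OF assms] by blast

end
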